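(* Let $\beta_1\neq\beta_2$ with $1<\beta_1,\beta_2<1.202$. Then $(\beta_1,\beta_2)\in\mathcal Z$, i.e. $(0,0)$ is an interior point of $A_{\beta_1,\beta_2}$.
   Context: For $\beta_1,\beta_2>1$ and $i\in\{-1,1\}$ let $T_i:\mathbb R^2\to\mathbb R^2$, $T_i(x,y)=\left(\frac{x+i}{\beta_1},\frac{y+i}{\beta_2}\right)$. Let $A=A_{\beta_1,\beta_2}$ be the attractor of $\{T_{-1},T_1\}$, i.e. the unique non-empty compact set with $A=T_1(A)\cup T_{-1}(A)$. Define $\mathcal Z=\{(\beta_1,\beta_2): (0,0)\in A^o\}$, where $A^o$ is the interior of $A$ in $\mathbb R^2$. *)

theory Defs
  imports "HOL-Analysis.Analysis"
begin

definition ifs_map :: "real \<Rightarrow> real \<Rightarrow> real \<Rightarrow> real \<times> real \<Rightarrow> real \<times> real" where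
  "ifs_map \<beta>1 \<beta>2 i = (\<lambda>(x, y). ((x + i) / \<beta>1, (y + i) / \<beta>2))"

definition is_attractor :: "real \<Rightarrow> real \<Rightarrow> (real \<times> real) set \<Rightarrow> bool" where
  "is_attractor \<beta>1 \<beta>2 K \<longleftrightarrow>
     K \<noteq> {} \<and> compact K \<and> K = ifs_map \<beta>1 \<beta>2 1 ` K \<union> ifs_map \<beta>1 \<beta>2 (-1) ` K"

text \<open>The description is proper for \<open>\<beta>1, \<beta>2 > 1\<close>, see \<open>is_attractor_ex1\<close> below.\<close>

definition attractor :: "real \<Rightarrow> real \<Rightarrow> (real \<times> real) set" where
  "attractor \<beta>1 \<beta>2 = (THE K. is_attractor \<beta>1 \<beta>2 K)"

definition interior_params :: "(real \<times> real) set" where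
  "interior_params =
     {(\<beta>1, \<beta>2). \<beta>1 > 1 \<and> \<beta>2 > 1 \<and> (0, 0) \<in> interior (attractor \<beta>1 \<beta>2)}"

lemma ifs_map_contraction:
  assumes "\<beta>1 > 1" "\<beta>2 > 1"
  shows "dist (ifs_map \<beta>1 \<beta>2 i p) (ifs_map \<beta>1 \<beta>2 i q) \<le> dist p q / min \<beta>1 \<beta>2"
proof -
  obtain x y u v where pq: "p = (x, y)" "q = (u, v)" by (metis surj_pair)
  define m where "m = min \<beta>1 \<beta>2"
  have m: "m > 0" "m \<le> \<beta>1" "m \<le> \<beta>2" using assms by (auto simp: m_def)
  have shrink: "(dist ((s + i) / b) ((t + i) / b))\<^sup>2 \<le> (dist s t)\<^sup>2 / m\<^sup>2"
    if "m \<le> b" for s t b :: real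
  proof -
    have "(s + i) / b - (t + i) / b = (s - t) / b"
      by (simp add: diff_divide_distrib[symmetric])
    then have "(dist ((s + i) / b) ((t + i) / b))\<^sup>2 = (dist s t)\<^sup>2 / b\<^sup>2"
      by (simp add: dist_real_def power_divide)
    also have "\<dots> \<le> (dist s t)\<^sup>2 / m\<^sup>2"
      using that m by (intro divide_left_mono power_mono) auto
    finally show ?thesis .
  qed
  have "dist (ifs_map \<beta>1 \<beta>2 i p) (ifs_map \<beta>1 \<beta>2 i q)
      \<le> sqrt ((dist x u)\<^sup>2 / m\<^sup>2 + (dist y v)\<^sup>2 / m\<^sup>2)"
    unfolding pq ifs_map_def dist_Pair_Pair prod.case
    using m by (intro real_sqrt_le_mono add_mono shrink)
  also have "\<dots> = dist p q / m"
    using m by (simp add: pq dist_Pair_Pair add_divide_distrib[symmetric] real_sqrt_divide)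
  finally show ?thesis by (simp add: m_def)
qed

lemma continuous_on_ifs_map: "continuous_on K (ifs_map \<beta>1 \<beta>2 i)"
  unfolding ifs_map_def case_prod_beta divide_inverse by (intro continuous_intros)

lemma is_attractor_subset:
  assumes b: "\<beta>1 > 1" "\<beta>2 > 1"
    and A: "is_attractor \<beta>1 \<beta>2 A" and B: "is_attractor \<beta>1 \<beta>2 B"
  shows "A \<subseteq> B"
proof -
  have cA: "compact A" "A \<noteq> {}" and cB: "compact B" "B \<noteq> {}"
    using A B by (auto simp: is_attractor_def)
  have "continuous_on A (\<lambda>a. infdist a B)" by (intro continuous_intros)
  with cA obtain a where a: "a \<in> A" and max: "\<And>z. z \<in> A \<Longrightarrow> infdist z B \<le> infdist a B"
    using continuous_attains_sup by metis
  from a A obtain i a' where a': "a' \<in> A" "a = ifs_map \<beta>1 \<beta>2 i a'" and i: "i = 1 \<or> i = -1"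
    unfolding is_attractor_def by blast
  have "closed B" using cB by (simp add: compact_imp_closed)
  then obtain b' where b': "b' \<in> B" "infdist a' B = dist a' b'"
    using infdist_attains_inf[of B a'] cB by auto
  have "ifs_map \<beta>1 \<beta>2 i b' \<in> B" using B b' i unfolding is_attractor_def by blast
  then have "infdist a B \<le> dist a (ifs_map \<beta>1 \<beta>2 i b')" by (rule infdist_le)
  also have "\<dots> \<le> dist a' b' / min \<beta>1 \<beta>2" using ifs_map_contraction[OF b] a' by simp
  also have "\<dots> \<le> infdist a B / min \<beta>1 \<beta>2"
    using max[OF a'(1)] b' b by (intro divide_right_mono) auto
  finally have le: "infdist a B * min \<beta>1 \<beta>2 \<le> infdist a B"
    using b by (simp add: pos_le_divide_eq)
  have "infdist a B = 0"
  proof (rule ccontr)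
    assume "infdist a B \<noteq> 0"
    then have "infdist a B > 0" using infdist_nonneg[of a B] by linarith
    then have "infdist a B * 1 < infdist a B * min \<beta>1 \<beta>2"
      using b by (intro mult_strict_left_mono) auto
    with le show False by simp
  qed
  then have "infdist z B = 0" if "z \<in> A" for z
    using max[OF that] infdist_nonneg[of z B] by linarith
  then show ?thesis using \<open>closed B\<close> cB in_closed_iff_infdist_zero by blast
qed

lemma is_attractor_exists:
  assumes b: "\<beta>1 > 1" "\<beta>2 > 1"
  shows "\<exists>K. is_attractor \<beta>1 \<beta>2 K"
proof -
  define F where "F K = ifs_map \<beta>1 \<beta>2 1 ` K \<union> ifs_map \<beta>1 \<beta>2 (-1) ` K" for K
  define S where "S b = {-(1 / (b - 1)) .. 1 / (b - 1)}" for b :: real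
  define Q where "Q n = (F ^^ n) (S \<beta>1 \<times> S \<beta>2)" for n
  have Q_Suc: "Q (Suc n) = F (Q n)" for n by (simp add: Q_def)
  have F_mono: "F K \<subseteq> F L" if "K \<subseteq> L" for K L using that by (auto simp: F_def)
  have step: "(x + i) / b \<in> S b" if "b > 1" "x \<in> S b" "i = 1 \<or> i = -1" for x i b :: real
  proof -
    have e: "1 / (b - 1) * b = 1 / (b - 1) + 1" using that by (simp add: field_simps)
    have "x + i \<le> 1 / (b - 1) * b" "- (1 / (b - 1)) * b \<le> x + i"
      using that e by (auto simp: S_def)
    then have "(x + i) / b \<le> 1 / (b - 1)" "- (1 / (b - 1)) \<le> (x + i) / b"
      using that(1) pos_divide_le_eq[of b "x + i"] pos_le_divide_eq[of b _ "x + i"] by force+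
    then show ?thesis by (simp add: S_def)
  qed
  have Q0: "F (Q 0) \<subseteq> Q 0"
    using step[of _ _ 1] step[of _ _ "-1"] b by (auto simp: F_def Q_def ifs_map_def)
  have dec: "Q (Suc n) \<subseteq> Q n" for n
    by (induction n) (use Q0 F_mono Q_Suc in auto)
  have anti: "Q n \<subseteq> Q m" if "m \<le> n" for m n
    using dec that by (rule lift_Suc_antimono_le)
  have cpt: "compact (Q n)" for n
  proof (induction n)
    case 0
    then show ?case by (auto simp: Q_def S_def intro: compact_Times)
  next
    case (Suc n)
    then show ?case unfolding Q_Suc F_def
      by (intro compact_Un compact_continuous_image continuous_on_ifs_map)
  qed
  have ne: "Q n \<noteq> {}" for n
  proof (induction n)
    case 0
    then show ?case using b by (auto simp: Q_def S_def)
  next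
    case (Suc n)
    then show ?case unfolding Q_Suc F_def by auto
  qed
  define K where "K = (\<Inter>n. Q n)"
  have "K \<noteq> {}"
    unfolding K_def using compact_nest[of Q] cpt ne anti by blast
  moreover have "compact K"
    unfolding K_def by (rule compact_Inter) (use cpt in auto)
  moreover have "K = F K"
  proof
    show "F K \<subseteq> K"
    proof -
      have "F K \<subseteq> Q n" for n
        using F_mono[of K "Q n"] dec[of n] Q_Suc[of n] by (auto simp: K_def)
      then show ?thesis by (auto simp: K_def)
    qed
    have inj: "inj (ifs_map \<beta>1 \<beta>2 i)" for i
      using b by (auto simp: inj_def ifs_map_def)
    show "K \<subseteq> F K"
    proof
      fix z assume z: "z \<in> K"
      have cov: "z \<in> F (Q n)" for n
        using z Q_Suc[of n] unfolding K_def by blast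
      show "z \<in> F K"
      proof (rule ccontr)
        assume nz: "z \<notin> F K"
        have ev: "\<exists>n. \<forall>m\<ge>n. z \<notin> ifs_map \<beta>1 \<beta>2 i ` Q m" if i: "i = 1 \<or> i = -1" for i
        proof -
          have "z \<notin> ifs_map \<beta>1 \<beta>2 i ` K" using nz i by (auto simp: F_def)
          also have "ifs_map \<beta>1 \<beta>2 i ` K = (\<Inter>n. ifs_map \<beta>1 \<beta>2 i ` Q n)"
            unfolding K_def by (rule image_INT[OF inj]) auto
          finally obtain n where "z \<notin> ifs_map \<beta>1 \<beta>2 i ` Q n" by auto
          then show ?thesis using anti by blast
        qed
        obtain n1 n2 where "\<forall>m\<ge>n1. z \<notin> ifs_map \<beta>1 \<beta>2 1 ` Q m"
          "\<forall>m\<ge>n2. z \<notin> ifs_map \<beta>1 \<beta>2 (-1) ` Q m" using ev[of 1] ev[of "-1"] by auto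
        then have "z \<notin> F (Q (max n1 n2))" by (simp add: F_def)
        with cov show False by blast
      qed
    qed
  qed
  ultimately show ?thesis unfolding is_attractor_def F_def by blast
qed

lemma is_attractor_ex1:
  assumes "\<beta>1 > 1" "\<beta>2 > 1"
  shows "\<exists>!K. is_attractor \<beta>1 \<beta>2 K"
  using is_attractor_exists[OF assms] is_attractor_subset[OF assms] by (metis subset_antisym)

lemma is_attractor_attractor:
  assumes "\<beta>1 > 1" "\<beta>2 > 1"
  shows "is_attractor \<beta>1 \<beta>2 (attractor \<beta>1 \<beta>2)"
  unfolding attractor_def by (rule theI'[OF is_attractor_ex1[OF assms]])

end

theory Submission
  imports Defs
begin

text \<open>
  The idea is to produce digit sequences by a feedback rule that keeps a finite memory bounded.
  Suppose that a monic polynomial \<open>P(z) = z^n + c\<^sub>n\<^sub>-\<^sub>1 z^(n-1) + \<dots> + c\<^sub>0\<close> vanishes at both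
  \<open>\<beta>1\<close> and \<open>\<beta>2\<close>, and that \<open>\<bar>c\<^sub>0\<bar> + \<dots> + \<bar>c\<^sub>n\<^sub>-\<^sub>1\<bar> \<le> 2\<close>. Given real numbers
  \<open>w\<^sub>0, \<dots>, w\<^sub>n\<^sub>-\<^sub>1\<close> in \<open>[-1, 1]\<close>, extend them to an infinite sequence by
  \<open>w\<^sub>m\<^sub>+\<^sub>n = i - (c\<^sub>0 w\<^sub>m + \<dots> + c\<^sub>n\<^sub>-\<^sub>1 w\<^sub>m\<^sub>+\<^sub>n\<^sub>-\<^sub>1)\<close>. The bracket lies in \<open>[-2, 2]\<close>,
  so a digit \<open>i = 1\<close> or \<open>i = -1\<close> can be chosen at each time to keep the new value in \<open>[-1, 1]\<close>.
  When the digits so obtained are summed against \<open>\<beta>^(-k)\<close>, where \<open>\<beta>\<close> is either of the two roots,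
  the terms with later values \<open>w\<^sub>m\<close> cancel because \<open>P(\<beta>) = 0\<close>. What remains is a linear form
  in the initial memory. So for every initial memory in the cube \<open>[-1, 1]^n\<close> the pair of these
  two forms is a point of the attractor. If \<open>c\<^sub>0 \<noteq> 0\<close> and \<open>\<beta>1 \<noteq> \<beta>2\<close>, the two forms are
  linearly independent already on \<open>(w\<^sub>0, w\<^sub>1)\<close>, and these points fill a neighbourhood of the
  origin (\<open>origin_interior_of_common_root\<close>).

  The bookkeeping with infinite series is avoided: the set \<open>E\<close> of the points described satisfies
  \<open>E \<subseteq> T\<^sub>1(E) \<union> T\<^sub>-\<^sub>1(E)\<close>, because one step of the recursion only shifts the memory, and a
  bounded set with this property lies in the attractor (\<open>subset_attractorI\<close>).

  It remains to find the polynomial. There is exactly one trinomial \<open>z^(N+1) - a z^N + b\<close> that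
  vanishes at \<open>\<beta>1\<close> and \<open>\<beta>2\<close>. Its coefficients are positive and increase with both roots, so for
  roots up to \<open>c\<close> the sum \<open>a + b\<close> is at most its value \<open>((N+1) c + c^(N+1)) / N\<close> at the
  double root \<open>c\<close> (\<open>trinomial_with_two_roots\<close>). For \<open>N = 7\<close> and \<open>c = 1.202\<close> this is
  \<open>1.996\<dots>\<close>; no other \<open>N\<close> gives at most \<open>2\<close> for this \<open>c\<close>.
\<close>

section \<open>Bounded sets covered by their own images\<close>

text \<open>
  Each point of \<open>E\<close> is the image of a point of \<open>E\<close> under a contraction that maps the attractor
  into itself. So the supremum \<open>d\<close> of the distances from points of \<open>E\<close> to the attractor, which is
  finite for bounded \<open>E\<close>, satisfies \<open>d \<le> d / min \<beta>1 \<beta>2\<close> and is zero.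
\<close>
lemma subset_attractorI:
  assumes b: "\<beta>1 > 1" "\<beta>2 > 1"
    and bdd: "bounded E"
    and cov: "\<And>z. z \<in> E \<Longrightarrow> \<exists>i\<in>{1, -1}. \<exists>z'\<in>E. z = ifs_map \<beta>1 \<beta>2 i z'"
  shows "E \<subseteq> attractor \<beta>1 \<beta>2"
proof (cases "E = {}")
  case False
  define A where "A = attractor \<beta>1 \<beta>2"
  define m where "m = min \<beta>1 \<beta>2"
  have m: "m > 1" using b by (simp add: m_def)
  have A: "A \<noteq> {}" "compact A" "A = ifs_map \<beta>1 \<beta>2 1 ` A \<union> ifs_map \<beta>1 \<beta>2 (-1) ` A"
    using is_attractor_attractor[OF b] unfolding is_attractor_def A_def by blast+
  have cl: "closed A" using A(2) by (rule compact_imp_closed)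
  obtain p where p: "p \<in> A" using A(1) by blast
  obtain R where R: "\<And>z. z \<in> E \<Longrightarrow> dist p z \<le> R"
    using bdd bounded_any_center[of E p] by blast
  define d where "d = (SUP z\<in>E. infdist z A)"
  have bdd_dist: "bdd_above ((\<lambda>z. infdist z A) ` E)"
    using R infdist_le[OF p] by (intro bdd_aboveI2[of _ _ R]) (metis dist_commute order_trans)
  have le_d: "infdist z A \<le> d" if "z \<in> E" for z
    unfolding d_def using that bdd_dist by (rule cSUP_upper)
  have "infdist z A \<le> d / m" if z: "z \<in> E" for z
  proof -
    obtain i z' where i: "i = 1 \<or> i = -1" and z': "z' \<in> E" "z = ifs_map \<beta>1 \<beta>2 i z'"
      using cov[OF z] by auto
    obtain q where q: "q \<in> A" "infdist z' A = dist z' q"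
      using infdist_attains_inf[OF cl A(1)] by blast
    have "ifs_map \<beta>1 \<beta>2 i q \<in> A" using A(3) q(1) i by blast
    then have "infdist z A \<le> dist z (ifs_map \<beta>1 \<beta>2 i q)" by (rule infdist_le)
    also have "\<dots> \<le> dist z' q / m"
      using ifs_map_contraction[OF b] z'(2) by (simp add: m_def)
    also have "\<dots> \<le> d / m"
      using le_d[OF z'(1)] q(2) m by (intro divide_right_mono) auto
    finally show ?thesis .
  qed
  then have "d \<le> d / m"
    unfolding d_def using False by (intro cSUP_least) (auto simp: d_def)
  then have "d * (m - 1) \<le> 0" using m by (simp add: field_simps)
  then have "d \<le> 0" using m by (simp add: mult_le_0_iff)
  then have "infdist z A = 0" if "z \<in> E" for z
    using le_d[OF that] infdist_nonneg[of z A] by linarith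
  then show ?thesis
    using in_closed_iff_infdist_zero[OF cl A(1)] unfolding A_def by blast
qed simp

section \<open>The feedback recursion\<close>

text \<open>
  These are the weights of the initial memory in the value of the digit series: for a root \<open>\<beta>\<close>,
  the series with base \<open>\<beta>\<close> equals the sum of \<open>w\<^sub>k\<close> times the weight with index \<open>k + 1\<close>. Up to
  the factor \<open>\<beta>^k\<close>, the weight with index \<open>k\<close> is the value at \<open>\<beta>\<close> of the part of the
  polynomial of degree below \<open>k\<close>.
\<close>
primrec memory_weight :: "(nat \<Rightarrow> real) \<Rightarrow> real \<Rightarrow> nat \<Rightarrow> real" where
  "memory_weight c \<beta> 0 = 0"
| "memory_weight c \<beta> (Suc k) = (memory_weight c \<beta> k + c k) / \<beta>"

lemma power_times_memory_weight:
  assumes "\<beta> \<noteq> 0"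
  shows "\<beta> ^ k * memory_weight c \<beta> k = (\<Sum>j<k. c j * \<beta> ^ j)"
proof (induction k)
  case (Suc k)
  have "\<beta> ^ Suc k * memory_weight c \<beta> (Suc k) = \<beta> ^ k * memory_weight c \<beta> k + c k * \<beta> ^ k"
    using assms by (simp add: field_simps)
  then show ?case using Suc by simp
qed simp

lemma memory_weight_at_root:
  assumes "\<beta> \<noteq> 0" and "\<beta> ^ n + (\<Sum>j<n. c j * \<beta> ^ j) = 0"
  shows "memory_weight c \<beta> n = -1"
proof -
  have "\<beta> ^ n * memory_weight c \<beta> n = \<beta> ^ n * (-1)"
    using power_times_memory_weight[OF assms(1), of n c] assms(2) by simp
  then show ?thesis using assms(1) by (simp only: mult_cancel_left) simp
qed

definition memory_form :: "nat \<Rightarrow> (nat \<Rightarrow> real) \<Rightarrow> real \<Rightarrow> (nat \<Rightarrow> real) \<Rightarrow> real" where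
  "memory_form n c \<beta> w = (\<Sum>k<n. w k * memory_weight c \<beta> (Suc k))"

definition shift_memory :: "nat \<Rightarrow> (nat \<Rightarrow> real) \<Rightarrow> real \<Rightarrow> (nat \<Rightarrow> real) \<Rightarrow> nat \<Rightarrow> real" where
  "shift_memory n c i w k = (if Suc k = n then i - (\<Sum>j<n. c j * w j) else w (Suc k))"

text \<open>
  This is where the root condition enters: it gives the new memory entry the weight \<open>-1\<close>, which
  is exactly what compensates the feedback term.
\<close>
lemma memory_form_shift:
  assumes "\<beta> \<noteq> 0" and root: "\<beta> ^ n + (\<Sum>j<n. c j * \<beta> ^ j) = 0"
  shows "memory_form n c \<beta> w = (memory_form n c \<beta> (shift_memory n c i w) + i) / \<beta>"
proof -
  obtain N where n: "n = Suc N" using root by (cases n) auto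
  have "\<beta> * memory_form n c \<beta> w = (\<Sum>k<n. w k * (memory_weight c \<beta> k + c k))"
    unfolding memory_form_def sum_distrib_left using assms(1) by (intro sum.cong) auto
  also have "\<dots> = (\<Sum>k<n. w k * memory_weight c \<beta> k) + (\<Sum>k<n. c k * w k)"
    by (simp add: algebra_simps sum.distrib)
  also have "(\<Sum>k<n. w k * memory_weight c \<beta> k)
      = (\<Sum>k<N. w (Suc k) * memory_weight c \<beta> (Suc k))"
    unfolding n sum.lessThan_Suc_shift by simp
  also have "\<dots> = (\<Sum>k<N. shift_memory n c i w k * memory_weight c \<beta> (Suc k))"
    by (intro sum.cong) (auto simp: shift_memory_def n)
  also have "\<dots> = memory_form n c \<beta> (shift_memory n c i w) + shift_memory n c i w N"
    using memory_weight_at_root[OF assms]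
    by (simp add: memory_form_def n del: memory_weight.simps)
  also have "shift_memory n c i w N = i - (\<Sum>k<n. c k * w k)"
    by (simp add: shift_memory_def n)
  finally show ?thesis using assms(1) by (simp add: field_simps)
qed

lemma stable_digit_exists:
  fixes w :: "nat \<Rightarrow> real"
  assumes small: "(\<Sum>j<n. \<bar>c j\<bar>) \<le> 2" and w: "\<forall>k. \<bar>w k\<bar> \<le> 1"
  shows "\<exists>i\<in>{1, -1}. \<forall>k. \<bar>shift_memory n c i w k\<bar> \<le> 1"
proof -
  define s where "s = (\<Sum>j<n. c j * w j)"
  have "\<bar>s\<bar> \<le> (\<Sum>j<n. \<bar>c j * w j\<bar>)" unfolding s_def by (rule sum_abs)
  also have "\<dots> \<le> (\<Sum>j<n. \<bar>c j\<bar>)"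
    using w by (intro sum_mono) (simp add: abs_mult mult_left_le)
  finally have "\<bar>s\<bar> \<le> 2" using small by linarith
  then have "\<bar>(if s \<ge> 0 then 1 else -1) - s\<bar> \<le> 1" by auto
  then show ?thesis
    using w unfolding shift_memory_def s_def[symmetric]
    by (intro bexI[of _ "if s \<ge> 0 then 1 else -1"]) auto
qed

lemma memory_points_subset_attractor:
  assumes b: "\<beta>1 > 1" "\<beta>2 > 1"
    and root1: "\<beta>1 ^ n + (\<Sum>j<n. c j * \<beta>1 ^ j) = 0"
    and root2: "\<beta>2 ^ n + (\<Sum>j<n. c j * \<beta>2 ^ j) = 0"
    and small: "(\<Sum>j<n. \<bar>c j\<bar>) \<le> 2"
  shows "(\<lambda>w. (memory_form n c \<beta>1 w, memory_form n c \<beta>2 w)) ` {w. \<forall>k. \<bar>w k\<bar> \<le> 1}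
      \<subseteq> attractor \<beta>1 \<beta>2"
    (is "?f ` ?W \<subseteq> _")
proof (rule subset_attractorI[OF b])
  define C where "C \<beta> = (\<Sum>k<n. \<bar>memory_weight c \<beta> (Suc k)\<bar>)" for \<beta>
  have bound: "\<bar>memory_form n c \<beta> w\<bar> \<le> C \<beta>" if "w \<in> ?W" for w \<beta>
  proof -
    have "\<bar>memory_form n c \<beta> w\<bar> \<le> (\<Sum>k<n. \<bar>w k * memory_weight c \<beta> (Suc k)\<bar>)"
      unfolding memory_form_def by (rule sum_abs)
    also have "\<dots> \<le> C \<beta>"
      unfolding C_def abs_mult using that by (intro sum_mono mult_left_le_one_le) auto
    finally show ?thesis .
  qed
  have "?f ` ?W \<subseteq> {- C \<beta>1..C \<beta>1} \<times> {- C \<beta>2..C \<beta>2}"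
  proof (rule image_subsetI)
    fix w assume "w \<in> ?W"
    then show "?f w \<in> {- C \<beta>1..C \<beta>1} \<times> {- C \<beta>2..C \<beta>2}"
      using bound[of w \<beta>1] bound[of w \<beta>2] by (auto simp: abs_le_iff)
  qed
  then show "bounded (?f ` ?W)"
    by (rule bounded_subset[rotated]) (intro bounded_Times bounded_closed_interval)
next
  fix z assume "z \<in> ?f ` ?W"
  then obtain w where w: "\<forall>k. \<bar>w k\<bar> \<le> 1" and z: "z = ?f w" by auto
  obtain i where i: "i \<in> {1, -1}" and w': "\<forall>k. \<bar>shift_memory n c i w k\<bar> \<le> 1"
    using stable_digit_exists[OF small w] by blast
  have "z = ifs_map \<beta>1 \<beta>2 i (?f (shift_memory n c i w))"
    unfolding z ifs_map_def prod.case prod.inject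
    using b by (intro conjI memory_form_shift root1 root2) auto
  then show "\<exists>i\<in>{1, -1}. \<exists>z'\<in>?f ` ?W. z = ifs_map \<beta>1 \<beta>2 i z'"
    using w' by (intro bexI[OF _ i] bexI[OF _ imageI]) simp_all
qed

text \<open>
  Two free memory entries suffice to reach a neighbourhood of the origin in the plane. For the
  oldest two, the \<open>2 \<times> 2\<close> determinant is \<open>c\<^sub>0\<^sup>2 (\<beta>1 - \<beta>2) / (\<beta>1 \<beta>2)\<^sup>2\<close>.
\<close>
theorem origin_interior_of_common_root:
  assumes b: "\<beta>1 > 1" "\<beta>2 > 1" "\<beta>1 \<noteq> \<beta>2"
    and root1: "\<beta>1 ^ n + (\<Sum>j<n. c j * \<beta>1 ^ j) = 0"
    and root2: "\<beta>2 ^ n + (\<Sum>j<n. c j * \<beta>2 ^ j) = 0"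
    and small: "(\<Sum>j<n. \<bar>c j\<bar>) \<le> 2"
    and n: "n \<ge> 2" and c0: "c 0 \<noteq> 0"
  shows "(0, 0) \<in> interior (attractor \<beta>1 \<beta>2)"
proof -
  define p where "p \<beta> = memory_weight c \<beta> 1" for \<beta>
  define q where "q \<beta> = memory_weight c \<beta> 2" for \<beta>
  define D where "D = p \<beta>1 * q \<beta>2 - p \<beta>2 * q \<beta>1"
  have "D = (c 0)\<^sup>2 * (\<beta>1 - \<beta>2) / (\<beta>1 * \<beta>2)\<^sup>2"
    using b by (simp add: D_def p_def q_def numeral_2_eq_2 field_simps)
  then have D: "D \<noteq> 0" using b c0 by simp
  \<comment> \<open>Cramer's rule: the memory entries \<open>w\<^sub>0\<close> and \<open>w\<^sub>1\<close> that represent the point \<open>z\<close>.\<close>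
  define s where "s z = (fst z * q \<beta>2 - snd z * q \<beta>1) / D" for z :: "real \<times> real"
  define t where "t z = (p \<beta>1 * snd z - p \<beta>2 * fst z) / D" for z :: "real \<times> real"
  define U where "U = {z. \<bar>s z\<bar> < 1} \<inter> {z. \<bar>t z\<bar> < 1}"
  show ?thesis
  proof (rule interiorI)
    show "open U"
      unfolding U_def s_def t_def divide_inverse
      by (intro open_Int open_Collect_less continuous_intros)
    show "(0, 0) \<in> U" by (simp add: U_def s_def t_def)
    show "U \<subseteq> attractor \<beta>1 \<beta>2"
    proof
      fix z assume z: "z \<in> U"
      define w where "w k = (if k = 0 then s z else if k = 1 then t z else 0)" for k :: nat
      have form: "memory_form n c \<beta> w = s z * p \<beta> + t z * q \<beta>" for \<beta>
      proof -
        have "memory_form n c \<beta> w = (\<Sum>k\<in>{0, 1}. w k * memory_weight c \<beta> (Suc k))"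
          unfolding memory_form_def using n
          by (intro sum.mono_neutral_right) (auto simp: w_def)
        then show ?thesis by (simp add: w_def p_def q_def numeral_2_eq_2)
      qed
      have "s z * p \<beta>1 + t z * q \<beta>1 = fst z * D / D"
        unfolding s_def t_def times_divide_eq_left add_divide_distrib[symmetric]
        by (simp add: D_def algebra_simps)
      moreover have "s z * p \<beta>2 + t z * q \<beta>2 = snd z * D / D"
        unfolding s_def t_def times_divide_eq_left add_divide_distrib[symmetric]
        by (simp add: D_def algebra_simps)
      ultimately have "z = (memory_form n c \<beta>1 w, memory_form n c \<beta>2 w)"
        using D by (simp add: form prod_eq_iff)
      moreover have "\<forall>k. \<bar>w k\<bar> \<le> 1" using z by (auto simp: w_def U_def)
      ultimately show "z \<in> attractor \<beta>1 \<beta>2"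
        using memory_points_subset_attractor[OF b(1,2) root1 root2 small] by blast
    qed
  qed
qed

section \<open>A trinomial with two prescribed roots\<close>

definition homogeneous_sum :: "nat \<Rightarrow> real \<Rightarrow> real \<Rightarrow> real" where
  "homogeneous_sum N x y = (\<Sum>i<N. y ^ (N - Suc i) * x ^ i)"

lemma power_diff_homogeneous_sum: "x ^ N - y ^ N = (x - y) * homogeneous_sum N x y"
  unfolding homogeneous_sum_def by (rule power_diff_sumr2)

lemma homogeneous_sum_commute: "homogeneous_sum N x y = homogeneous_sum N y x"
  unfolding homogeneous_sum_def
  by (subst sum.nat_diff_reindex[symmetric], rule sum.cong) simp_all

lemma homogeneous_sum_diagonal: "homogeneous_sum N x x = real N * x ^ (N - 1)"
  by (simp add: homogeneous_sum_def power_add[symmetric])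

lemma homogeneous_sum_pos:
  assumes "N > 0" "x > 0" "y > 0"
  shows "homogeneous_sum N x y > 0"
  unfolding homogeneous_sum_def using assms by (intro sum_pos) auto

text \<open>
  The reciprocal of the quotient is the sum of \<open>x^i / y^(i+1)\<close> over \<open>i < N\<close>, and each of these
  terms decreases in \<open>y\<close>.
\<close>
lemma power_over_homogeneous_sum_mono:
  assumes "N > 0" "x > 0" "y > 0" "y \<le> z"
  shows "y ^ N / homogeneous_sum N x y \<le> z ^ N / homogeneous_sum N x z"
proof -
  have "y ^ N * homogeneous_sum N x z \<le> z ^ N * homogeneous_sum N x y"
    unfolding homogeneous_sum_def sum_distrib_left
  proof (rule sum_mono)
    fix i assume "i \<in> {..<N}"
    then have split: "a ^ N = a ^ Suc i * a ^ (N - Suc i)" for a :: real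
      by (simp only: power_add[symmetric]) simp
    have "y ^ Suc i \<le> z ^ Suc i" using assms by (intro power_mono) auto
    then have "y ^ Suc i * (y ^ (N - Suc i) * z ^ (N - Suc i) * x ^ i)
        \<le> z ^ Suc i * (y ^ (N - Suc i) * z ^ (N - Suc i) * x ^ i)"
      using assms by (intro mult_right_mono) auto
    then show "y ^ N * (z ^ (N - Suc i) * x ^ i) \<le> z ^ N * (y ^ (N - Suc i) * x ^ i)"
      unfolding split[of y] split[of z] by (simp only: ac_simps)
  qed
  then show ?thesis
    using assms homogeneous_sum_pos[of N x y] homogeneous_sum_pos[of N x z]
    by (simp add: field_simps)
qed

text \<open>
  Solving the two linear equations gives \<open>b = x^N y^N / h\<close> and \<open>a = x + y^N / h\<close>, where \<open>h\<close> is
  the sum of the \<open>x^i y^(N-1-i)\<close>. Both are symmetric in \<open>x\<close> and \<open>y\<close> and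
  increase in \<open>y\<close>, hence in both variables, so they may be compared with their values at
  \<open>x = y = C\<close>.
\<close>
lemma trinomial_with_two_roots:
  fixes x y C :: real
  assumes N: "N > 0" and x: "0 < x" "x \<le> C" and y: "0 < y" "y \<le> C"
  obtains a b where "a > 0" "b > 0"
    "x ^ Suc N - a * x ^ N + b = 0" "y ^ Suc N - a * y ^ N + b = 0"
    "a + b \<le> (real (Suc N) * C + C ^ Suc N) / N"
proof
  define h where "h = homogeneous_sum N x y"
  have h: "h > 0" unfolding h_def using N x y by (intro homogeneous_sum_pos)
  have C: "C > 0" using x by linarith
  have diff: "(x - y) * h = x ^ N - y ^ N"
    by (simp add: h_def power_diff_homogeneous_sum)
  show "x + y ^ N / h > 0" "x ^ N * (y ^ N / h) > 0" using x y h by (auto intro: add_pos_pos)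
  show "x ^ Suc N - (x + y ^ N / h) * x ^ N + x ^ N * (y ^ N / h) = 0"
    by (simp add: algebra_simps)
  have "x + y ^ N / h = y + x ^ N / h" using diff h by (simp add: field_simps)
  then show "y ^ Suc N - (x + y ^ N / h) * y ^ N + x ^ N * (y ^ N / h) = 0"
    by (simp add: algebra_simps)
  define k where "k = homogeneous_sum N x C"
  have k: "k > 0" unfolding k_def using N x C by (intro homogeneous_sum_pos)
  have "(x - C) * k = x ^ N - C ^ N"
    by (simp add: k_def power_diff_homogeneous_sum)
  then have swap: "x + C ^ N / k = C + x ^ N / k" using k by (simp add: field_simps)
  have first: "y ^ N / h \<le> C ^ N / k"
    unfolding h_def k_def using N x y by (intro power_over_homogeneous_sum_mono)
  have diag: "C ^ N / homogeneous_sum N C C = C / N"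
    using N C by (cases N) (auto simp: homogeneous_sum_diagonal)
  have second: "x ^ N / k \<le> C / N"
    using power_over_homogeneous_sum_mono[OF N C x] diag
    by (simp add: k_def homogeneous_sum_commute[of N x C])
  have "x + y ^ N / h \<le> C + C / N" using first second swap by linarith
  moreover have "x ^ N * (y ^ N / h) \<le> C ^ N * (C / N)"
  proof -
    have "x ^ N * (y ^ N / h) \<le> x ^ N * (C ^ N / k)"
      using first x by (intro mult_left_mono) auto
    also have "\<dots> = C ^ N * (x ^ N / k)" by simp
    also have "\<dots> \<le> C ^ N * (C / N)" using second C by (intro mult_left_mono) auto
    finally show ?thesis .
  qed
  ultimately have "x + y ^ N / h + x ^ N * (y ^ N / h) \<le> C + C / N + C ^ N * (C / N)"
    by linarith
  also have "\<dots> = (real (Suc N) * C + C ^ Suc N) / N" using N by (simp add: field_simps)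
  finally show "x + y ^ N / h + x ^ N * (y ^ N / h) \<le> (real (Suc N) * C + C ^ Suc N) / N" .
qed

section \<open>Parameters below 1.202\<close>

theorem corollary1p3:
  fixes \<beta>1 \<beta>2 :: real
  assumes "\<beta>1 \<noteq> \<beta>2"
    and "1 < \<beta>1" "\<beta>1 < 1.202"
    and "1 < \<beta>2" "\<beta>2 < 1.202"
  shows "(\<beta>1, \<beta>2) \<in> interior_params"
proof -
  obtain a b where ab: "a > 0" "b > 0"
    and root: "\<beta>1 ^ Suc 7 - a * \<beta>1 ^ 7 + b = 0" "\<beta>2 ^ Suc 7 - a * \<beta>2 ^ 7 + b = 0"
    and le: "a + b \<le> (real (Suc 7) * 1.202 + 1.202 ^ Suc 7) / real 7"
    using trinomial_with_two_roots[of 7 \<beta>1 "1.202" \<beta>2] assms by auto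
  have "(real (Suc 7) * 1.202 + 1.202 ^ Suc 7) / real 7 \<le> (2 :: real)"
    by (simp add: power_divide)
  with le have sum_le: "a + b \<le> 2" by linarith
  define c where "c j = (if j = 0 then b else if j = 7 then - a else 0)" for j :: nat
  have c_sum: "(\<Sum>j<8. f (c j) j) = f b 0 + f (- a) 7" if "\<And>j. f 0 j = 0"
    for f :: "real \<Rightarrow> nat \<Rightarrow> real"
  proof -
    have "(\<Sum>j<8. f (c j) j) = (\<Sum>j\<in>{0, 7}. f (c j) j)"
      using that by (intro sum.mono_neutral_right) (auto simp: c_def)
    then show ?thesis by (simp add: c_def)
  qed
  have "(0, 0) \<in> interior (attractor \<beta>1 \<beta>2)"
  proof (rule origin_interior_of_common_root[where n = 8 and c = c])
    show "\<beta>1 ^ 8 + (\<Sum>j<8. c j * \<beta>1 ^ j) = 0" "\<beta>2 ^ 8 + (\<Sum>j<8. c j * \<beta>2 ^ j) = 0"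
      using root c_sum[of "\<lambda>u j. u * \<beta>1 ^ j"] c_sum[of "\<lambda>u j. u * \<beta>2 ^ j"] by simp_all
    show "(\<Sum>j<8. \<bar>c j\<bar>) \<le> 2"
      using c_sum[of "\<lambda>u j. \<bar>u\<bar>"] ab sum_le by simp
  qed (use assms ab in \<open>auto simp: c_def\<close>)
  then show ?thesis using assms by (simp add: interior_params_def)
qed

end
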